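(* Consider a finite-time MDP with horizon $H$ and rewards in $[0,R^*]$, with tabular softmax policies in each epoch. For all $h\in\mathcal H$ let $\mu_h$ be a probability measure on $\mathcal S_h$ with $\mu_h(s)>0$ for all $s\in\mathcal S_h$, and let $\eta_h=\frac{1}{2(H-h)R^*}$. For $\epsilon>0$ choose the number of training steps in epoch $h$ as $$N_h=\frac{4(H-h)HR^*}{c_h^2\,\epsilon}\Big\|\frac1{\mu_h}\Big\|_\infty$$ (rounded up to an integer). Let $\hat\pi^*=(\pi^{\theta_0^{(N_0)}},\dots,\pi^{\theta_{H-1}^{(N_{H-1})}})$ be the final policy of the dynamic policy gradient algorithm: for $h=H-1,\dots,0$ (backwards), starting from an initialisation $\theta_h^{(0)}\in\mathbb R^{d_h}$, run $$\theta_h^{(n+1)}=\theta_h^{(n)}+\eta_h\,\nabla_{\theta_h}V_h^{(\pi^{\theta_h},\hat\pi^*_{(h+1)})}(\mu_h)\Big|_{\theta_h=\theta_h^{(n)}},\qquad n=0,\dots,N_h-1,$$ and set $\hat\pi_h^*=\pi^{\theta_h^{(N_h)}}$. Then for all $s\in\mathcal S_0$, $$V_0^*(s)-V_0^{\hat\pi^*}(s)\le\epsilon .$$ If $\theta_h^{(0)}$ initialises the uniform distribution, the constants $c_h$ can be replaced by $\frac1{|\mathcal A|}$.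
   Context: A finite-time MDP is a tuple $(\mathcal H,\mathcal S,\mathcal A,r,p)$ with decision epochs $\mathcal H=\{0,\dots,H-1\}$, finite state space $\mathcal S=\mathcal S_0\cup\dots\cup\mathcal S_{H-1}$, finite action space $\mathcal A=\bigcup_{s\in\mathcal S}\mathcal A_s$, rewards $r:\mathcal S\times\mathcal A\to[0,R^*]$ with $R^*>0$, and transition function $p:\mathcal S\times\mathcal A\to\Delta(\mathcal S)$ with $p(\mathcal S_{h+1}\mid s,a)=1$ for $h<H-1$, $s\in\mathcal S_h$, $a\in\mathcal A_s$. A policy is $\pi=(\pi_h)_{h=0}^{H-1}$ with $\pi_h:\mathcal S_h\to\Delta(\mathcal A)$, $\pi_h(\mathcal A_s\mid s)=1$; $\pi_{(h)}=(\pi_k)_{k=h}^{H-1}$. $V_h^{\pi}(\mu_h)=\mathbb E_{\mu_h}^{\pi_{(h)}}[\sum_{k=h}^{H-1}r(S_k,A_k)]$, where $S_h\sim\mu_h$, $A_k\sim\pi_k(\cdot\mid S_k)$, $S_{k+1}\sim p(\cdot\mid S_k,A_k)$; $V_h^\pi(s)=V_h^\pi(\delta_s)$; $V_0^*(s)=\sup_\pi V_0^\pi(s)$. $Q_h^{\pi}(s,a)=r(s,a)+\sum_{s'\in\mathcal S_{h+1}}p(s'\mid s,a)V_{h+1}^{\pi}(s')$ for $h\le H-2$ and $Q_{H-1}=r$. Tabular softmax in epoch $h$: $d_h=\sum_{s\in\mathcal S_h}|\mathcal A_s|$, $\theta_h=(\theta_h(s,a))_{s\in\mathcal S_h,a\in\mathcal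 A_s}\in\mathbb R^{d_h}$, $\pi^{\theta_h}(a\mid s)=\exp(\theta_h(s,a))/\sum_{a'\in\mathcal A_s}\exp(\theta_h(s,a'))$. The policy $(\pi^{\theta_h},\hat\pi^*_{(h+1)})$ uses $\pi^{\theta_h}$ in epoch $h$ and the already trained policies afterwards. $\|1/\mu_h\|_\infty=\max_{s\in\mathcal S_h}1/\mu_h(s)$. The constant $c_h=\inf_{n\ge0}\min_{s\in\mathcal S_h}\pi^{\theta_h^{(n)}}(a_h^*(s)\mid s)$, where the infimum is along the (infinite) gradient ascent sequence of epoch $h$ and $a_h^*(s)\in\operatorname{argmax}_{a\in\mathcal A_s}Q_h^{\hat\pi^*}(s,a)$ is the best action in epoch $h$ given the fixed future policy $\hat\pi^*_{(h+1)}$; it is strictly positive according to a separate lemma of the paper. *)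

theory Defs
  imports "HOL-Probability.Probability"
begin

text \<open>
  The types \<open>'s\<close> and \<open>'a\<close> are the state space and the action space themselves, so that
  \<open>CARD('a)\<close> is the cardinality of the action space. The state sets \<open>states M h\<close> of the epochs
  need not be disjoint.
\<close>

record ('s, 'a) mdp =
  horizon :: nat
  states :: "nat \<Rightarrow> 's set"
  actions :: "'s \<Rightarrow> 'a set"
  reward :: "'s \<Rightarrow> 'a \<Rightarrow> real"
  trans :: "'s \<Rightarrow> 'a \<Rightarrow> 's pmf"

definition finite_time_mdp :: "('s::finite, 'a::finite) mdp \<Rightarrow> real \<Rightarrow> bool" where
  "finite_time_mdp M R \<longleftrightarrow>
     R > 0 \<and>
     (\<Union>h<horizon M. states M h) = UNIV \<and>
     (\<Union>s. actions M s) = UNIV \<and>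
     (\<forall>s. actions M s \<noteq> {}) \<and>
     (\<forall>s a. 0 \<le> reward M s a \<and> reward M s a \<le> R) \<and>
     (\<forall>h s a. h + 1 < horizon M \<longrightarrow> s \<in> states M h \<longrightarrow> a \<in> actions M s \<longrightarrow>
        measure_pmf.prob (trans M s a) (states M (h + 1)) = 1)"

text \<open>Only the values \<open>\<pi> h s\<close> with \<open>h < horizon M\<close> and \<open>s \<in> states M h\<close> are relevant.\<close>

type_synonym ('s, 'a) policy = "nat \<Rightarrow> 's \<Rightarrow> 'a pmf"

definition is_policy :: "('s::finite, 'a::finite) mdp \<Rightarrow> ('s, 'a) policy \<Rightarrow> bool" where
  "is_policy M \<pi> \<longleftrightarrow>
     (\<forall>h<horizon M. \<forall>s\<in>states M h. measure_pmf.prob (\<pi> h s) (actions M s) = 1)"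

text \<open>
  \<open>trajectory M \<pi> h n \<mu>\<close> is the joint law of \<open>(S\<^sub>h, A\<^sub>h), \<dots>, (S\<^bsub>h+n-1\<^esub>, A\<^bsub>h+n-1\<^esub>)\<close>
  when \<open>S\<^sub>h\<close> has law \<open>\<mu>\<close>.
\<close>

fun trajectory ::
  "('s::finite, 'a::finite) mdp \<Rightarrow> ('s, 'a) policy \<Rightarrow> nat \<Rightarrow> nat \<Rightarrow> 's pmf \<Rightarrow> ('s \<times> 'a) list pmf"
where
  "trajectory M \<pi> h 0 \<mu> = return_pmf []"
| "trajectory M \<pi> h (Suc n) \<mu> =
     bind_pmf \<mu> (\<lambda>s. bind_pmf (\<pi> h s) (\<lambda>a.
       map_pmf (\<lambda>\<tau>. (s, a) # \<tau>) (trajectory M \<pi> (h + 1) n (trans M s a))))"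

definition value_fun ::
  "('s::finite, 'a::finite) mdp \<Rightarrow> ('s, 'a) policy \<Rightarrow> nat \<Rightarrow> 's pmf \<Rightarrow> real" where
  "value_fun M \<pi> h \<mu> =
     measure_pmf.expectation (trajectory M \<pi> h (horizon M - h) \<mu>)
       (\<lambda>\<tau>. \<Sum>(s, a)\<leftarrow>\<tau>. reward M s a)"

definition opt_value :: "('s::finite, 'a::finite) mdp \<Rightarrow> 's \<Rightarrow> real" where
  "opt_value M s = (SUP \<pi>\<in>{\<pi>. is_policy M \<pi>}. value_fun M \<pi> 0 (return_pmf s))"

definition q_fun ::
  "('s::finite, 'a::finite) mdp \<Rightarrow> ('s, 'a) policy \<Rightarrow> nat \<Rightarrow> 's \<Rightarrow> 'a \<Rightarrow> real" where
  "q_fun M \<pi> h s a = reward M s a +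
     (if h + 1 < horizon M
      then \<Sum>s'\<in>states M (h + 1). pmf (trans M s a) s' * value_fun M \<pi> (h + 1) (return_pmf s')
      else 0)"

text \<open>
  A parameter of epoch \<open>h\<close> is a vector with index set \<open>{(s, a). s \<in> states M h \<and> a \<in> actions M s}\<close>.
  It is embedded in the space of vectors indexed by all pairs \<open>(s, a)\<close>. The other coordinates are
  dummies: the objective of epoch \<open>h\<close> does not depend on them, so its gradient vanishes there.
\<close>

type_synonym ('s, 'a) param = "real ^ ('s \<times> 'a)"

definition softmax ::
  "('s::finite, 'a::finite) mdp \<Rightarrow> ('s, 'a) param \<Rightarrow> 's \<Rightarrow> 'a pmf" where
  "softmax M \<theta> s = embed_pmf (\<lambda>a.
     if a \<in> actions M s then exp (\<theta> $ (s, a)) / (\<Sum>a'\<in>actions M s. exp (\<theta> $ (s, a'))) else 0)"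

lemma pmf_softmax:
  assumes "actions M s \<noteq> {}"
  shows "pmf (softmax M \<theta> s) a =
    (if a \<in> actions M s then exp (\<theta> $ (s, a)) / (\<Sum>a'\<in>actions M s. exp (\<theta> $ (s, a'))) else 0)"
proof -
  let ?Z = "\<Sum>a'\<in>actions M s. exp (\<theta> $ (s, a'))"
  let ?f = "\<lambda>a. if a \<in> actions M s then exp (\<theta> $ (s, a)) / ?Z else 0"
  have Z: "?Z > 0"
    using assms by (intro sum_pos) auto
  have nn: "?f b \<ge> 0" for b
    using Z by simp
  have "(\<integral>\<^sup>+b. ennreal (?f b) \<partial>count_space UNIV) = (\<Sum>b\<in>UNIV. ennreal (?f b))"
    by (simp add: nn_integral_count_space_finite)
  also have "\<dots> = ennreal (\<Sum>b\<in>UNIV. ?f b)"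
    using nn by (intro sum_ennreal) auto
  also have "(\<Sum>b\<in>UNIV. ?f b) = (\<Sum>b\<in>actions M s. exp (\<theta> $ (s, b)) / ?Z)"
    by (simp add: sum.If_cases)
  also have "\<dots> = 1"
    using Z by (simp flip: sum_divide_distrib)
  finally show ?thesis
    unfolding softmax_def using nn by (subst pmf_embed_pmf) auto
qed

definition gradient :: "('v::real_inner \<Rightarrow> real) \<Rightarrow> 'v \<Rightarrow> 'v" where
  "gradient f x = (THE g. GDERIV f x :> g)"

text \<open>
  A run of dynamic policy gradient: \<open>\<theta> h n\<close> is the \<open>n\<close>-th iterate of the (infinite) gradient
  ascent sequence of epoch \<open>h\<close>, started in \<open>\<theta> h 0\<close>, and \<open>\<pi>\<close> is the final policy. Since
  \<open>value_fun M \<pi>' h\<close> only depends on the epochs \<open>\<ge> h\<close> of \<open>\<pi>'\<close>, the update \<open>\<pi>(h := softmax M x)\<close>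
  yields softmax in epoch \<open>h\<close> followed by the already trained policies. For given initialisations
  \<open>\<theta> h 0\<close> the equations therefore determine \<open>\<theta> h\<close> and \<open>\<pi> h\<close> by backward recursion over \<open>h\<close>.
\<close>

definition dynamic_pg ::
  "('s::finite, 'a::finite) mdp \<Rightarrow> (nat \<Rightarrow> 's pmf) \<Rightarrow> (nat \<Rightarrow> real) \<Rightarrow> (nat \<Rightarrow> nat) \<Rightarrow>
   (nat \<Rightarrow> nat \<Rightarrow> ('s, 'a) param) \<Rightarrow> ('s, 'a) policy \<Rightarrow> bool" where
  "dynamic_pg M \<mu> \<eta> N \<theta> \<pi> \<longleftrightarrow>
     (\<forall>h<horizon M.
        (\<forall>n. \<theta> h (Suc n) = \<theta> h n +
           \<eta> h *\<^sub>R gradient (\<lambda>x. value_fun M (\<pi>(h := softmax M x)) h (\<mu> h)) (\<theta> h n)) \<and>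
        \<pi> h = softmax M (\<theta> h (N h)))"

definition best_actions ::
  "('s::finite, 'a::finite) mdp \<Rightarrow> ('s, 'a) policy \<Rightarrow> nat \<Rightarrow> 's \<Rightarrow> 'a set" where
  "best_actions M \<pi> h s = {a. is_arg_max (q_fun M \<pi> h s) (\<lambda>a'. a' \<in> actions M s) a}"

definition ascent_const ::
  "('s::finite, 'a::finite) mdp \<Rightarrow> (nat \<Rightarrow> nat \<Rightarrow> ('s, 'a) param) \<Rightarrow> (nat \<Rightarrow> 's \<Rightarrow> 'a) \<Rightarrow> nat \<Rightarrow> real"
where
  "ascent_const M \<theta> abest h =
     (INF n. Min ((\<lambda>s. pmf (softmax M (\<theta> h n) s) (abest h s)) ` states M h))"

definition inv_sup_norm ::
  "('s::finite, 'a::finite) mdp \<Rightarrow> (nat \<Rightarrow> 's pmf) \<Rightarrow> nat \<Rightarrow> real" where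
  "inv_sup_norm M \<mu> h = Max ((\<lambda>s. 1 / pmf (\<mu> h) s) ` states M h)"

text \<open>The constant \<open>c\<close> is a parameter, so that it can be replaced by \<open>1 / CARD('a)\<close>.\<close>

definition training_steps ::
  "('s::finite, 'a::finite) mdp \<Rightarrow> real \<Rightarrow> (nat \<Rightarrow> 's pmf) \<Rightarrow> real \<Rightarrow> nat \<Rightarrow> real \<Rightarrow> nat" where
  "training_steps M R \<mu> \<epsilon> h c =
     nat \<lceil>4 * real (horizon M - h) * real (horizon M) * R / (c\<^sup>2 * \<epsilon>) * inv_sup_norm M \<mu> h\<rceil>"

definition uniform_init ::
  "('s::finite, 'a::finite) mdp \<Rightarrow> (nat \<Rightarrow> nat \<Rightarrow> ('s, 'a) param) \<Rightarrow> nat \<Rightarrow> bool" where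
  "uniform_init M \<theta> h \<longleftrightarrow> (\<forall>s\<in>states M h. softmax M (\<theta> h 0) s = pmf_of_set (actions M s))"

end

theory Submission
  imports Defs
begin

text \<open>
  In epoch \<open>h\<close> the gradient decouples over states: the parameters of state \<open>s\<close> perform exact gradient
  ascent on a softmax bandit with rewards \<open>q = Q\<^sub>h(s, \<cdot>)\<close> and step size \<open>k = \<eta>\<^sub>h \<mu>\<^sub>h(s)\<close>. For one
  step \<open>y\<^sub>a = k p\<^sub>a (q\<^sub>a - v)\<close> of the bandit, with \<open>v\<close> its mean reward, the new mean satisfies
  \<open>v' - v = (\<Sum>\<^sub>a p\<^sub>a (q\<^sub>a - v) (exp y\<^sub>a - 1)) / (\<Sum>\<^sub>a p\<^sub>a exp y\<^sub>a)\<close>.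
  All terms of the numerator are nonnegative, and the one of the best action yields
  \<open>d' \<le> d - (k/2) c\<^sup>2 d\<^sup>2\<close> for the suboptimality \<open>d\<close>, hence \<open>d \<le> 2 / (k c\<^sup>2 n)\<close> after \<open>n\<close> steps. No
  smoothness estimate is needed. With the given number of steps every state is \<open>\<epsilon>/H\<close>-greedy, and the errors
  add up over the epochs. A best action that is initially a most likely one stays so, which gives
  \<open>1/|A|\<close> as constant for uniform initialisations. If the best action is unique, its probability tends to
  one because the mean rewards converge to the optimum, so its infimum is positive.
\<close>

subsection \<open>Gradient ascent for softmax bandits\<close>

definition softmax_weight :: "'a set \<Rightarrow> ('a \<Rightarrow> real) \<Rightarrow> 'a \<Rightarrow> real" where
  "softmax_weight A x a = exp (x a) / (\<Sum>b\<in>A. exp (x b))"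

definition softmax_mean :: "'a set \<Rightarrow> ('a \<Rightarrow> real) \<Rightarrow> ('a \<Rightarrow> real) \<Rightarrow> real" where
  "softmax_mean A q x = (\<Sum>a\<in>A. softmax_weight A x a * q a)"

lemma sum_exp_pos: "finite A \<Longrightarrow> A \<noteq> {} \<Longrightarrow> (\<Sum>b\<in>A. exp (x b :: real)) > 0"
  by (intro sum_pos) auto

lemma softmax_weight_pos: "finite A \<Longrightarrow> A \<noteq> {} \<Longrightarrow> softmax_weight A x a > 0"
  by (simp add: softmax_weight_def sum_exp_pos)

lemma sum_softmax_weight:
  assumes "finite A" "A \<noteq> {}"
  shows "(\<Sum>a\<in>A. softmax_weight A x a) = 1"
  using sum_exp_pos[OF assms, of x] by (simp add: softmax_weight_def flip: sum_divide_distrib)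

lemma softmax_weight_le_1:
  assumes "finite A" "a \<in> A"
  shows "softmax_weight A x a \<le> 1"
proof -
  have "A \<noteq> {}" using assms by auto
  then have "softmax_weight A x a \<le> (\<Sum>a\<in>A. softmax_weight A x a)"
    using assms softmax_weight_pos[OF assms(1), of x] by (intro member_le_sum) (auto intro: less_imp_le)
  then show ?thesis using sum_softmax_weight[of A x] assms \<open>A \<noteq> {}\<close> by simp
qed

lemma softmax_mean_le:
  assumes "finite A" "A \<noteq> {}" "\<And>a. a \<in> A \<Longrightarrow> q a \<le> B"
  shows "softmax_mean A q x \<le> B"
proof -
  have "softmax_mean A q x \<le> (\<Sum>a\<in>A. softmax_weight A x a * B)"
    unfolding softmax_mean_def using assms softmax_weight_pos[OF assms(1,2), of x]
    by (intro sum_mono mult_left_mono) (auto intro: less_imp_le)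
  then show ?thesis
    using sum_softmax_weight[OF assms(1,2), of x] by (simp flip: sum_distrib_right)
qed

lemma softmax_mean_ge:
  assumes "finite A" "A \<noteq> {}" "\<And>a. a \<in> A \<Longrightarrow> B \<le> q a"
  shows "B \<le> softmax_mean A q x"
  using softmax_mean_le[OF assms(1,2), of "\<lambda>a. - q a" "- B" x] assms(3)
  by (simp add: softmax_mean_def sum_negf)

lemma sum_softmax_weight_centered:
  assumes "finite A" "A \<noteq> {}"
  shows "(\<Sum>a\<in>A. softmax_weight A x a * (q a - B)) = softmax_mean A q x - B"
  using sum_softmax_weight[OF assms, of x]
  by (simp add: softmax_mean_def right_diff_distrib sum_subtractf flip: sum_distrib_right)

text \<open>A shift by \<open>y\<close> multiplies each weight by \<open>exp (y a)\<close> and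
  renormalises. Since the deviations from the mean have weighted sum zero, \<open>exp (y a)\<close>
  may be replaced by \<open>exp (y a) - 1\<close> in the numerator.\<close>

lemma softmax_mean_add_diff:
  assumes "finite A" "A \<noteq> {}"
  shows "softmax_mean A q (\<lambda>a. x a + y a) - softmax_mean A q x =
    (\<Sum>a\<in>A. softmax_weight A x a * ((q a - softmax_mean A q x) * (exp (y a) - 1))) /
    (\<Sum>a\<in>A. softmax_weight A x a * exp (y a))"
proof -
  let ?v = "softmax_mean A q x" and ?Z = "\<Sum>b\<in>A. exp (x b)"
  let ?D = "\<Sum>a\<in>A. softmax_weight A x a * exp (y a)"
  have Z: "?Z > 0" by (rule sum_exp_pos[OF assms])
  have D: "?D = (\<Sum>b\<in>A. exp (x b + y b)) / ?Z"
    by (simp add: softmax_weight_def exp_add sum_divide_distrib)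
  have "softmax_weight A (\<lambda>a. x a + y a) a = softmax_weight A x a * exp (y a) / ?D" for a
    unfolding D using Z by (simp add: softmax_weight_def exp_add)
  then have "softmax_mean A q (\<lambda>a. x a + y a) - ?v =
      (\<Sum>a\<in>A. softmax_weight A x a * exp (y a) * (q a - ?v)) / ?D"
    using sum_softmax_weight_centered[OF assms, where x = "\<lambda>a. x a + y a" and B = ?v and q = q]
    by (simp add: sum_divide_distrib)
  also have "(\<Sum>a\<in>A. softmax_weight A x a * exp (y a) * (q a - ?v)) =
      (\<Sum>a\<in>A. softmax_weight A x a * ((q a - ?v) * (exp (y a) - 1))) +
      (\<Sum>a\<in>A. softmax_weight A x a * (q a - ?v))"
    by (simp add: algebra_simps flip: sum.distrib)
  also have "(\<Sum>a\<in>A. softmax_weight A x a * (q a - ?v)) = 0"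
    using sum_softmax_weight_centered[OF assms, where x = x and B = ?v and q = q] by simp
  finally show ?thesis by simp
qed

text \<open>Discrete counterpart of the differential inequality d' \<le> - k d^2, whose positive
  solutions decay like 1 / (k n).\<close>

lemma quadratic_decrease_imp_inverse_rate:
  fixes d :: "nat \<Rightarrow> real"
  assumes "k \<ge> 0" and step: "\<And>n. d (Suc n) \<le> d n - k * (d n)\<^sup>2"
  shows "k * real n * d n \<le> 1"
proof (induction n)
  case (Suc n)
  define u where "u = k * d n"
  have u: "real n * u \<le> 1"
    using Suc by (simp add: u_def mult_ac)
  have "k * d (Suc n) \<le> k * (d n - k * (d n)\<^sup>2)"
    by (intro mult_left_mono step assms)
  also have "\<dots> = u * (1 - u)"
    by (simp add: u_def power2_eq_square algebra_simps)
  finally have 1: "k * d (Suc n) \<le> u * (1 - u)" .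
  have 2: "real (Suc n) * (u * (1 - u)) \<le> 1"
  \<comment> \<open>If \<open>u\<close> is already below 1 / (n + 1), the bound u (1 - u) \<le> u
    suffices. Otherwise the factor (n + 1) (1 - u) is below n, and the induction hypothesis n u
    \<le> 1 applies.\<close>
  proof (cases "real (Suc n) * u \<le> 1")
    case True
    have "real (Suc n) * (u * (1 - u)) \<le> real (Suc n) * u"
      using zero_le_square[of u] by (intro mult_left_mono) (auto simp: algebra_simps)
    then show ?thesis using True by linarith
  next
    case False
    then have "u > 0"
      by (smt (verit) mult_nonneg_nonpos of_nat_0_le_iff)
    have "real (Suc n) * (u * (1 - u)) = u * (real (Suc n) - real (Suc n) * u)"
      by (simp add: algebra_simps)
    also have "\<dots> \<le> u * real n"
      using False \<open>u > 0\<close> by (intro mult_left_mono) (auto simp: algebra_simps)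
    finally show ?thesis using u by (simp add: mult_ac)
  qed
  have "k * real (Suc n) * d (Suc n) = real (Suc n) * (k * d (Suc n))"
    by (simp add: mult_ac)
  also have "\<dots> \<le> real (Suc n) * (u * (1 - u))"
    by (intro mult_left_mono 1) simp
  finally show ?case using 2 by linarith
qed simp

text \<open>Models the parameters of one state during one epoch. The rewards \<open>q\<close> do not
  depend on \<open>n\<close> because the later epochs are already trained. The recursion is required
  on \<open>A\<close> only, the coordinates that the weights see.\<close>

locale softmax_ascent =
  fixes A :: "'a set" and q :: "'a \<Rightarrow> real" and k :: real and x :: "nat \<Rightarrow> 'a \<Rightarrow> real"
  assumes finite_A: "finite A" and A_ne: "A \<noteq> {}" and k_pos: "k > 0"
    and step: "a \<in> A \<Longrightarrow>
      x (Suc n) a = x n a + k * (softmax_weight A (x n) a * (q a - softmax_mean A q (x n)))"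
begin

section \<open>Monotone improvement and the inverse rate\<close>

abbreviation "p n a \<equiv> softmax_weight A (x n) a"
abbreviation "v n \<equiv> softmax_mean A q (x n)"
abbreviation "Z n \<equiv> \<Sum>b\<in>A. exp (x n b)"

lemma p_pos: "p n a > 0"
  by (rule softmax_weight_pos[OF finite_A A_ne])

lemma Z_pos: "Z n > 0"
  by (rule sum_exp_pos[OF finite_A A_ne])

lemma mean_step:
  "v (Suc n) - v n =
    (\<Sum>a\<in>A. p n a * ((q a - v n) * (exp (k * (p n a * (q a - v n))) - 1))) /
    (\<Sum>a\<in>A. p n a * exp (k * (p n a * (q a - v n))))"
proof -
  have "softmax_mean A q (x (Suc n)) = softmax_mean A q (\<lambda>a. x n a + k * (p n a * (q a - v n)))"
    by (simp add: softmax_mean_def softmax_weight_def step)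
  then show ?thesis by (simp add: softmax_mean_add_diff[OF finite_A A_ne])
qed

text \<open>The exponent is a positive multiple of \<open>q a - v n\<close>, so
  \<open>exp (...) - 1\<close> has the same sign as this deviation.\<close>

lemma gain_term_nonneg: "0 \<le> p n a * ((q a - v n) * (exp (k * (p n a * (q a - v n))) - 1))"
proof -
  have "0 \<le> (q a - v n) * (exp (k * (p n a * (q a - v n))) - 1)"
  proof (cases "q a \<ge> v n")
    case True
    then show ?thesis using k_pos p_pos[of n a] by (intro mult_nonneg_nonneg) auto
  next
    case False
    then have "k * (p n a * (q a - v n)) \<le> 0"
      using k_pos p_pos[of n a] by (intro mult_nonneg_nonpos) auto
    then show ?thesis using False by (intro mult_nonpos_nonpos) auto
  qed
  then show ?thesis using p_pos[of n a] by simp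
qed

lemma mean_incseq: "incseq v"
proof (rule incseq_SucI)
  fix n
  have "v (Suc n) - v n \<ge> 0"
    unfolding mean_step using gain_term_nonneg p_pos
    by (intro divide_nonneg_nonneg sum_nonneg) (auto intro: less_imp_le)
  then show "v n \<le> v (Suc n)" by simp
qed

text \<open>In the quotient for the gain, all exponents are at most 1/2, so the denominator is at
  most 2. In the numerator only the term of \<open>b\<close> is kept and linearised by 1 + y \<le>
  exp y.\<close>

lemma mean_step_ge:
  assumes q: "\<And>a. a \<in> A \<Longrightarrow> 0 \<le> q a \<and> q a \<le> C" and kC: "k * C \<le> 1 / 2"
    and b: "b \<in> A" "v n \<le> q b"
  shows "v (Suc n) \<ge> v n + k / 2 * (p n b * (q b - v n))\<^sup>2"
proof -
  let ?y = "\<lambda>a. k * (p n a * (q a - v n))"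
  let ?G = "\<Sum>a\<in>A. p n a * ((q a - v n) * (exp (?y a) - 1))"
  let ?D = "\<Sum>a\<in>A. p n a * exp (?y a)"
  have v0: "0 \<le> v n" using q by (intro softmax_mean_ge finite_A A_ne) auto
  have C: "0 \<le> C" using q b by force
  have "exp (?y a) \<le> 2" if "a \<in> A" for a
  proof -
    have "p n a * (q a - v n) \<le> 1 * C"
    proof (cases "q a \<ge> v n")
      case True
      then show ?thesis using q[OF that] v0 softmax_weight_le_1[OF finite_A that] p_pos[of n a]
        by (intro mult_mono) auto
    next
      case False
      then have "p n a * (q a - v n) \<le> 0"
        using p_pos[of n a] by (intro mult_nonneg_nonpos) auto
      then show ?thesis using C by simp
    qed
    then have "?y a \<le> 1 / 2"
      using kC k_pos mult_left_mono[of "p n a * (q a - v n)" C k] by linarith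
    then have "exp (?y a) \<le> exp (1 / 2)" by simp
    \<comment> \<open>The quadratic bound gives 1 + 1/2 + 1/4.\<close>
    also have "\<dots> \<le> 2"
      using exp_bound[of "1/2"] by (simp add: power2_eq_square)
    finally show ?thesis .
  qed
  then have "?D \<le> (\<Sum>a\<in>A. p n a * 2)"
    using p_pos by (intro sum_mono mult_left_mono) (auto intro: less_imp_le)
  also have "\<dots> = 2"
    using sum_softmax_weight[OF finite_A A_ne, of "x n"] by (simp flip: sum_distrib_right)
  finally have D: "?D \<le> 2" .
  have D0: "?D > 0" using finite_A A_ne p_pos by (intro sum_pos) auto
  have "k * (p n b * (q b - v n))\<^sup>2 = p n b * ((q b - v n) * ?y b)"
    by (simp add: power2_eq_square)
  also have "\<dots> \<le> p n b * ((q b - v n) * (exp (?y b) - 1))"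
    using b p_pos[of n b] exp_ge_add_one_self[of "?y b"]
    by (intro mult_left_mono) (linarith | simp)+
  also have "\<dots> \<le> ?G"
    using gain_term_nonneg by (intro member_le_sum finite_A b) auto
  finally have G: "k * (p n b * (q b - v n))\<^sup>2 \<le> ?G" .
  have "k / 2 * (p n b * (q b - v n))\<^sup>2 = k * (p n b * (q b - v n))\<^sup>2 / 2" by simp
  also have "\<dots> \<le> ?G / ?D"
    using G D D0 gain_term_nonneg by (intro frac_le sum_nonneg) auto
  also have "\<dots> = v (Suc n) - v n" by (simp only: mean_step)
  finally show ?thesis by simp
qed

text \<open>For a best action \<open>b\<close> whose weight never falls below \<open>c\<close>, the
  one-step gain is a quadratic decrease of the suboptimality with constant
  \<open>k / 2 * c\<^sup>2\<close>.\<close>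

lemma suboptimality_rate:
  assumes q: "\<And>a. a \<in> A \<Longrightarrow> 0 \<le> q a \<and> q a \<le> C" and kC: "k * C \<le> 1 / 2"
    and b: "b \<in> A" "\<And>a. a \<in> A \<Longrightarrow> q a \<le> q b"
    and c: "c > 0" "\<And>n. c \<le> p n b"
  shows "k / 2 * c\<^sup>2 * real n * (q b - v n) \<le> 1"
proof (rule quadratic_decrease_imp_inverse_rate)
  fix n
  have v: "v n \<le> q b" using b by (intro softmax_mean_le finite_A A_ne) auto
  then have "(c * (q b - v n))\<^sup>2 \<le> (p n b * (q b - v n))\<^sup>2"
    using c by (intro power_mono mult_right_mono) auto
  then have "k / 2 * (c * (q b - v n))\<^sup>2 \<le> k / 2 * (p n b * (q b - v n))\<^sup>2"
    using k_pos by (intro mult_left_mono) auto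
  then show "q b - v (Suc n) \<le> q b - v n - k / 2 * c\<^sup>2 * (q b - v n)\<^sup>2"
    using mean_step_ge[OF q kC b(1) v] by (simp add: power_mult_distrib)
qed (use k_pos in simp)

text \<open>If \<open>b\<close> has the larger parameter, it also has the larger weight. As its
  deviation from the mean is nonnegative and maximal, its increment is then the larger one too, so
  the order is preserved.\<close>

lemma best_stays_most_likely:
  assumes b: "b \<in> A" "\<And>a. a \<in> A \<Longrightarrow> q a \<le> q b" and init: "\<And>a. a \<in> A \<Longrightarrow> x 0 a \<le> x 0 b"
    and a: "a \<in> A"
  shows "x n a \<le> x n b"
proof (induction n)
  case (Suc n)
  have v: "v n \<le> q b" using b by (intro softmax_mean_le finite_A A_ne) auto
  have p: "p n a \<le> p n b"
    using Suc Z_pos[of n] by (simp add: softmax_weight_def divide_right_mono)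
  have "p n a * (q a - v n) \<le> p n a * (q b - v n)"
    using b a p_pos[of n a] by (intro mult_left_mono) auto
  also have "\<dots> \<le> p n b * (q b - v n)"
    using v p by (intro mult_right_mono) auto
  finally have "k * (p n a * (q a - v n)) \<le> k * (p n b * (q b - v n))"
    using k_pos by (intro mult_left_mono) auto
  then show ?case using Suc a b by (simp add: step)
qed (use init a in auto)

text \<open>The largest weight is at least the average weight.\<close>

lemma best_weight_ge_inverse_card:
  assumes "b \<in> A" "\<And>a. a \<in> A \<Longrightarrow> q a \<le> q b" "\<And>a. a \<in> A \<Longrightarrow> x 0 a \<le> x 0 b"
  shows "1 / real (card A) \<le> p n b"
proof -
  have "p n a \<le> p n b" if "a \<in> A" for a
    using best_stays_most_likely[OF assms that] Z_pos[of n]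
    by (simp add: softmax_weight_def divide_right_mono)
  then have "(\<Sum>a\<in>A. p n a) \<le> (\<Sum>a\<in>A. p n b)" by (intro sum_mono)
  then show ?thesis
    using sum_softmax_weight[OF finite_A A_ne, of "x n"] finite_A A_ne
    by (simp add: field_simps card_gt_0_iff)
qed

section \<open>Convergence of the mean rewards to the optimum\<close>

lemma sum_param_const: "(\<Sum>a\<in>A. x n a) = (\<Sum>a\<in>A. x 0 a)"
proof (induction n)
  case (Suc n)
  have "(\<Sum>a\<in>A. x (Suc n) a) = (\<Sum>a\<in>A. x n a) + k * (\<Sum>a\<in>A. p n a * (q a - v n))"
    by (simp add: step sum.distrib sum_distrib_left)
  \<comment> \<open>The increments add up to zero because the deviations are centred at the
    mean.\<close>
  then show ?case
    using Suc sum_softmax_weight_centered[OF finite_A A_ne, of "x n" q "v n"] by simp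
qed simp

lemma param_incseq:
  assumes "a \<in> A" "\<And>n. v n \<le> q a"
  shows "incseq (\<lambda>n. x n a)"
  using assms k_pos p_pos by (intro incseq_SucI) (simp add: step less_imp_le)

text \<open>
  If the parameter of one action that eventually looks bad stayed bounded below, the reciprocal
  normalisers would be summable, which bounds all parameters below. As their sum is
  constant, the normalisers would then be bounded, a contradiction.
\<close>

lemma bad_param_unbounded_below:
  assumes lim: "\<And>n. v n \<le> w" "\<And>e. e < w \<Longrightarrow> \<exists>n. e < v n" and b: "b \<in> A" "q b < w"
  shows "\<exists>n. x n b < L"
proof (rule ccontr)
  assume "\<not> (\<exists>n. x n b < L)"
  then have L: "L \<le> x n b" for n by (auto simp: not_less)
  \<comment> \<open>The means increase, so once they exceed \<open>q a\<close> they stay above it by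
    a fixed gap.\<close>
  have bad: "\<exists>m d. d > 0 \<and> (\<forall>n\<ge>m. v n - q a \<ge> d)" if "q a < w" for a
  proof -
    from lim(2)[OF that] obtain m where m: "q a < v m" by auto
    show ?thesis
      using m incseqD[OF mean_incseq] by (intro exI[of _ m] exI[of _ "v m - q a"]) auto
  qed
  obtain m d where d: "d > 0" "\<And>n. n \<ge> m \<Longrightarrow> v n - q b \<ge> d"
    using bad[OF b(2)] by auto
  \<comment> \<open>The weight of \<open>b\<close> is at least \<open>exp L / Z n\<close> and the
    gap at least \<open>d\<close>, so each late step costs a fixed multiple of
    \<open>1 / Z n\<close>. The total loss is bounded, which makes these reciprocals
    summable.\<close>
  have dec: "x (Suc n) b \<le> x n b - k * d * exp L * (1 / Z n)" if "n \<ge> m" for n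
  proof -
    have "k * d * exp L * (1 / Z n) = k * (exp L / Z n * d)" by simp
    also have "\<dots> \<le> k * (p n b * (v n - q b))"
      using d(1) d(2)[OF that] k_pos L[of n] Z_pos[of n]
      by (intro mult_left_mono mult_mono) (auto simp: softmax_weight_def divide_right_mono)
    finally show ?thesis using b by (simp add: step algebra_simps)
  qed
  have tele: "k * d * exp L * (\<Sum>i<n. 1 / Z (i + m)) \<le> x m b - x (n + m) b" for n
  proof (induction n)
    case (Suc n)
    then show ?case using dec[of "n + m"] by (simp add: algebra_simps)
  qed simp
  have kdL: "k * d * exp L > 0" using d k_pos by simp
  have "(\<Sum>i<n. 1 / Z (i + m)) \<le> (x m b - L) / (k * d * exp L)" for n
    using tele[of n] L[of "n + m"] kdL by (simp add: field_simps)
  then have "summable (\<lambda>i. 1 / Z (i + m))"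
    using Z_pos by (intro bounded_imp_summable[where B = "(x m b - L) / (k * d * exp L)"])
      (auto simp: less_imp_le simp del: sum.lessThan_Suc simp flip: lessThan_Suc_atMost)
  then have summ: "summable (\<lambda>i. 1 / Z i)"
    using summable_iff_shift[of "\<lambda>i. 1 / Z i" m] by blast
  \<comment> \<open>Actions not worse than \<open>w\<close> have increasing parameters. The
    parameter of a worse action is bounded above, so its losses are dominated by the summable
    \<open>1 / Z n\<close>.\<close>
  have "\<exists>l. \<forall>n. l \<le> x n a" if a: "a \<in> A" for a
  proof (cases "q a < w")
    case False
    then have "v n \<le> q a" for n using lim(1)[of n] by simp
    then have "incseq (\<lambda>n. x n a)" by (intro param_incseq a)
    then show ?thesis by (intro exI[of _ "x 0 a"]) (auto simp: incseq_def)
  next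
    case True
    obtain m' d' where d': "d' > 0" "\<And>n. n \<ge> m' \<Longrightarrow> v n - q a \<ge> d'"
      using bad[OF True] by auto
    have "p n a * (q a - v n) \<le> 0" if "n \<ge> m'" for n
      using d'(1) d'(2)[OF that] p_pos[of n a] by (intro mult_nonneg_nonpos) auto
    then have dec': "x (Suc n) a \<le> x n a" if "n \<ge> m'" for n
      using that k_pos by (simp add: step a mult_nonneg_nonpos)
    have late: "x n a \<le> x m' a" if "n \<ge> m'" for n
      using that by (induction n rule: dec_induct) (auto intro: order.trans dec')
    \<comment> \<open>The parameter decreases from \<open>m'\<close> on, so its finitely many
      earlier values bound it from above.\<close>
    define U where "U = Max ((\<lambda>i. x i a) ` {..m'})"
    have early: "x n a \<le> U" if "n \<le> m'" for n
      unfolding U_def using that by (intro Max_ge) auto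
    have up: "x n a \<le> U" for n
      using early[of n] early[of m'] late[of n] by (cases "n \<le> m'") auto
    define D where "D = exp U * (w - q a)"
    have D: "x n a - k * D * (1 / Z n) \<le> x (Suc n) a" for n
    proof -
      have "p n a * (v n - q a) \<le> p n a * (w - q a)"
        using lim(1)[of n] p_pos[of n a] by (intro mult_left_mono) auto
      also have "\<dots> \<le> exp U / Z n * (w - q a)"
        using True up[of n] Z_pos[of n] unfolding softmax_weight_def
        by (intro mult_right_mono divide_right_mono) auto
      finally have "p n a * (v n - q a) \<le> D * (1 / Z n)" by (simp add: D_def)
      then have "k * (p n a * (v n - q a)) \<le> k * (D * (1 / Z n))"
        using k_pos by (intro mult_left_mono) auto
      then show ?thesis using a by (simp add: step algebra_simps)
    qed
    have lower: "x 0 a - k * D * (\<Sum>i<n. 1 / Z i) \<le> x n a" for n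
    proof (induction n)
      case (Suc n)
      then show ?case using D[of n] by (simp add: algebra_simps)
    qed simp
    have upper: "k * D * (\<Sum>i<n. 1 / Z i) \<le> k * D * (\<Sum>i. 1 / Z i)" for n
      using k_pos True Z_pos summ
      by (intro mult_left_mono sum_le_suminf) (auto simp: D_def intro: less_imp_le)
    have "x 0 a - k * D * (\<Sum>i. 1 / Z i) \<le> x n a" for n
      using lower[of n] upper[of n] by linarith
    then show ?thesis by blast
  qed
  then obtain l where l: "\<And>a n. a \<in> A \<Longrightarrow> l a \<le> x n a" by metis
  \<comment> \<open>A parameter is the constant total minus the other parameters, each of which is
    bounded below.\<close>
  define U where "U = (\<Sum>a\<in>A. x 0 a) + (\<Sum>a\<in>A. \<bar>l a\<bar>)"
  have U: "x n a \<le> U" if "a \<in> A" for n a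
  proof -
    have "x n a + (\<Sum>c\<in>A - {a}. x n c) = (\<Sum>c\<in>A. x 0 c)"
      using that finite_A sum_param_const[of n] by (simp add: sum.remove)
    moreover have "- (\<Sum>c\<in>A - {a}. \<bar>l c\<bar>) \<le> (\<Sum>c\<in>A - {a}. x n c)"
      unfolding sum_negf[symmetric] using l by (intro sum_mono) (auto simp: abs_le_iff, smt (verit))
    moreover have "(\<Sum>c\<in>A - {a}. \<bar>l c\<bar>) \<le> (\<Sum>c\<in>A. \<bar>l c\<bar>)"
      using finite_A by (intro sum_mono2) auto
    ultimately show ?thesis by (simp add: U_def)
  qed
  have Zle: "Z n \<le> real (card A) * exp U" for n
    using sum_bounded_above[of A "\<lambda>a. exp (x n a)" "exp U"] U by auto
  \<comment> \<open>Summability would force the normalisers to infinity, but they are bounded by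
    \<open>card A * exp U\<close>.\<close>
  have "(\<lambda>i. 1 / Z i) \<longlonglongrightarrow> 0" using summ by (rule summable_LIMSEQ_zero)
  then have "1 / (real (card A) * exp U) \<le> 0"
    using Zle Z_pos by (intro LIMSEQ_le_const[of "\<lambda>i. 1 / Z i"]) (auto intro!: frac_le)
  moreover have "real (card A) * exp U > 0" using finite_A A_ne by (simp add: card_gt_0_iff)
  ultimately show False by (meson not_less zero_less_divide_1_iff)
qed

text \<open>The means increase to some \<open>w\<close>. If \<open>w\<close> were below
  \<open>q b\<close>, the actions worse than \<open>w\<close> would lose all their unnormalised
  weight, whereas that of \<open>b\<close> never decreases. The mean would then eventually exceed
  \<open>w\<close>.\<close>

lemma mean_tendsto_best:
  assumes b: "b \<in> A" "\<And>a. a \<in> A \<Longrightarrow> q a \<le> q b"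
  shows "v \<longlonglongrightarrow> q b"
proof -
  have vb: "v n \<le> q b" for n using b by (intro softmax_mean_le finite_A A_ne) auto
  then have bdd: "bdd_above (range v)" by (auto intro!: bdd_aboveI)
  define w where "w = (SUP n. v n)"
  have lim: "v \<longlonglongrightarrow> w" unfolding w_def by (rule LIMSEQ_incseq_SUP[OF bdd mean_incseq])
  have vw: "v n \<le> w" for n unfolding w_def by (rule cSUP_upper[OF _ bdd]) simp
  have near: "\<exists>n. e < v n" if "e < w" for e
    using that less_cSUP_iff[OF _ bdd, of e] unfolding w_def by auto
  have "\<not> w < q b"
  proof
    assume wb: "w < q b"
    define I where "I = {a\<in>A. q a < w}"
    have bot: "filterlim (\<lambda>n. x n a) at_bot sequentially" if "a \<in> I" for a
    proof -
      from that have a: "a \<in> A" "q a < w" by (auto simp: I_def)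
      obtain m where m: "q a < v m" using near[OF a(2)] by auto
      have neg: "p n a * (q a - v n) \<le> 0" if "n \<ge> m" for n
        using m incseqD[OF mean_incseq that] p_pos[of n a] by (intro mult_nonneg_nonpos) auto
      have dec: "x (Suc n) a \<le> x n a" if "n \<ge> m" for n
        using neg[OF that] k_pos by (simp add: step a mult_nonneg_nonpos)
      show ?thesis
        unfolding filterlim_at_bot
      proof
        fix L
        \<comment> \<open>Undercutting the first values as well forces \<open>n0\<close> beyond
          \<open>m\<close>, where the parameter is already decreasing and hence stays below
          \<open>L\<close>.\<close>
        obtain n0 where n0: "x n0 a < min L (Min ((\<lambda>i. x i a) ` {..m}))"
          using bad_param_unbounded_below[OF vw near a] by blast
        have "n0 > m"
        proof (rule ccontr)
          assume "\<not> n0 > m"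
          then have "Min ((\<lambda>i. x i a) ` {..m}) \<le> x n0 a" by (intro Min_le) auto
          then show False using n0 by linarith
        qed
        have "x n a \<le> L" if "n \<ge> n0" for n
          using that
        proof (induction n rule: dec_induct)
          case (step n)
          then show ?case using dec[of n] \<open>n0 > m\<close> by simp
        qed (use n0 in simp)
        then show "\<forall>\<^sub>F n in sequentially. x n a \<le> L" by (auto simp: eventually_sequentially)
      qed
    qed
    have "(\<lambda>n. \<Sum>a\<in>I. exp (x n a) * (w - q a)) \<longlonglongrightarrow> (\<Sum>a\<in>I. 0 * (w - q a))"
      using bot by (intro tendsto_sum tendsto_mult tendsto_const filterlim_compose[OF exp_at_bot]) auto
    then have lim0: "(\<lambda>n. \<Sum>a\<in>I. exp (x n a) * (w - q a)) \<longlonglongrightarrow> 0" by simp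
    \<comment> \<open>As the mean is at most \<open>w\<close>, the actions of \<open>I\<close> must
      compensate for the surplus of \<open>b\<close>; all other actions outside \<open>I\<close>
      contribute nonnegatively. The left side is a positive constant, the right side tends to
      0.\<close>
    have "exp (x 0 b) * (q b - w) \<le> (\<Sum>a\<in>I. exp (x n a) * (w - q a))" for n
    proof -
      have "(\<Sum>a\<in>A. exp (x n a) * (q a - w)) = Z n * (\<Sum>a\<in>A. p n a * (q a - w))"
        using Z_pos[of n] by (simp add: softmax_weight_def sum_distrib_left)
      also have "\<dots> = Z n * (v n - w)"
        using sum_softmax_weight_centered[OF finite_A A_ne, of "x n" q w] by simp
      also have "\<dots> \<le> 0" using Z_pos[of n] vw[of n] by (intro mult_nonneg_nonpos) auto
      finally have "(\<Sum>a\<in>A - I. exp (x n a) * (q a - w)) + (\<Sum>a\<in>I. exp (x n a) * (q a - w)) \<le> 0"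
        using sum.subset_diff[of I A "\<lambda>a. exp (x n a) * (q a - w)"] finite_A by (auto simp: I_def)
      moreover have "exp (x n b) * (q b - w) \<le> (\<Sum>a\<in>A - I. exp (x n a) * (q a - w))"
        using finite_A b wb by (intro member_le_sum) (auto simp: I_def)
      moreover have "exp (x 0 b) * (q b - w) \<le> exp (x n b) * (q b - w)"
        using incseqD[OF param_incseq[OF b(1) vb], of 0 n] wb by (intro mult_right_mono) auto
      moreover have "(\<Sum>a\<in>I. exp (x n a) * (q a - w)) = - (\<Sum>a\<in>I. exp (x n a) * (w - q a))"
        by (simp add: algebra_simps flip: sum_negf)
      ultimately show ?thesis by linarith
    qed
    then have "exp (x 0 b) * (q b - w) \<le> 0"
      by (intro LIMSEQ_le_const[OF lim0]) auto
    then show False using wb by (simp add: mult_le_0_iff)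
  qed
  then have "w = q b" using LIMSEQ_le_const2[OF lim, of "q b"] vb by fastforce
  then show ?thesis using lim by simp
qed

text \<open>Every unit of weight missing at \<open>b\<close> costs at least the gap \<open>g\<close>
  to the second best action. As the mean tends to \<open>q b\<close>, the missing weight
  vanishes.\<close>

lemma unique_best_weight_bounded_below:
  assumes b: "b \<in> A" "\<And>a. a \<in> A \<Longrightarrow> a \<noteq> b \<Longrightarrow> q a < q b"
  shows "\<exists>c>0. \<forall>n. c \<le> p n b"
proof -
  \<comment> \<open>The inserted 1 keeps the set nonempty if \<open>b\<close> is the only
    action.\<close>
  define g where "g = Min (insert 1 ((\<lambda>a. q b - q a) ` (A - {b})))"
  have g: "g > 0" using b finite_A by (auto simp: g_def)
  have gq: "g \<le> q b - q a" if "a \<in> A - {b}" for a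
    unfolding g_def using finite_A that by (intro Min_le) auto
  have "g * (1 - p n b) \<le> q b - v n" for n
  proof -
    have "1 - p n b = (\<Sum>a\<in>A - {b}. p n a)"
      using sum_softmax_weight[OF finite_A A_ne, of "x n"] b finite_A by (simp add: sum.remove)
    then have "g * (1 - p n b) = (\<Sum>a\<in>A - {b}. p n a * g)"
      by (simp add: sum_distrib_left mult.commute)
    also have "\<dots> \<le> (\<Sum>a\<in>A - {b}. p n a * (q b - q a))"
      using gq p_pos by (intro sum_mono mult_left_mono) (auto intro: less_imp_le)
    also have "\<dots> = (\<Sum>a\<in>A. p n a * (q b - q a))"
      using b finite_A by (simp add: sum.remove)
    also have "\<dots> = - (\<Sum>a\<in>A. p n a * (q a - q b))"
      by (simp add: algebra_simps flip: sum_negf)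
    finally show ?thesis
      using sum_softmax_weight_centered[OF finite_A A_ne, of "x n" q "q b"] by simp
  qed
  moreover have "q a \<le> q b" if "a \<in> A" for a using b(2)[OF that] by (cases "a = b") auto
  then have "v \<longlonglongrightarrow> q b" by (intro mean_tendsto_best b)
  then have "\<forall>\<^sub>F n in sequentially. q b - g / 2 < v n"
    using g by (intro order_tendstoD) auto
  then obtain m where m: "\<And>n. n \<ge> m \<Longrightarrow> q b - g / 2 < v n"
    by (auto simp: eventually_sequentially)
  ultimately have "g * (1 - p n b) < g / 2" if "n \<ge> m" for n
    using m[OF that] by (smt (verit))
  then have "g * (1 - p n b) < g * (1 / 2)" if "n \<ge> m" for n
    using that by simp
  then have half: "1 / 2 < p n b" if "n \<ge> m" for n
    using g that mult_less_cancel_left_pos[OF g] by fastforce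
  \<comment> \<open>The tail stays above 1/2; the finitely many earlier weights are
    positive.\<close>
  define c where "c = Min (insert (1 / 2) ((\<lambda>n. p n b) ` {..m}))"
  have "c > 0" using p_pos by (auto simp: c_def)
  moreover have "c \<le> p n b" for n
  proof (cases "n \<le> m")
    case True
    then show ?thesis unfolding c_def by (intro Min_le) auto
  next
    case False
    have "c \<le> 1 / 2" by (auto simp: c_def intro!: Min_le)
    then show ?thesis using half[of n] False by simp
  qed
  ultimately show ?thesis by blast
qed

end

subsection \<open>Value functions and policy gradients\<close>

lemma pmf_eq_0_outside:
  assumes "measure_pmf.prob p A = 1" "a \<notin> A"
  shows "pmf p a = 0"
  using assms by (metis measure_pmf.prob_eq_1 AE_measure_pmf_iff sets_measure_pmf UNIV_I set_pmf_iff)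

lemma finite_set_trajectory: "finite (set_pmf (trajectory M \<pi> h n \<mu>))"
  by (induction n arbitrary: h \<mu>) auto

lemma trajectory_cong_future:
  "(\<And>k. k \<ge> h \<Longrightarrow> \<pi> k = \<pi>' k) \<Longrightarrow> trajectory M \<pi> h n \<mu> = trajectory M \<pi>' h n \<mu>"
proof (induction n arbitrary: h \<mu>)
  case (Suc n)
  have "trajectory M \<pi> (h + 1) n \<nu> = trajectory M \<pi>' (h + 1) n \<nu>" for \<nu>
    using Suc.prems by (intro Suc.IH) auto
  then show ?case using Suc.prems[of h] by simp
qed simp

lemma value_fun_cong_future:
  "(\<And>k. k \<ge> h \<Longrightarrow> \<pi> k = \<pi>' k) \<Longrightarrow> value_fun M \<pi> h \<mu> = value_fun M \<pi>' h \<mu>"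
  unfolding value_fun_def using trajectory_cong_future[of h \<pi> \<pi>'] by simp

lemma value_fun_end: "horizon M \<le> h \<Longrightarrow> value_fun M \<pi> h \<mu> = 0"
  by (simp add: value_fun_def)

lemma value_fun_eq_sum:
  "value_fun M \<pi> h \<mu> = (\<Sum>s\<in>UNIV. pmf \<mu> s * value_fun M \<pi> h (return_pmf s))"
proof (cases "horizon M - h")
  case 0
  then show ?thesis by (simp add: value_fun_def)
next
  case (Suc n)
  show ?thesis
    unfolding value_fun_def Suc trajectory.simps bind_return_pmf
    by (subst pmf_expectation_bind[of UNIV]) (auto intro: finite_set_trajectory)
qed

text \<open>Bellman equation for a fixed policy. The continuation is kept as the value of the law
  \<open>trans M s a\<close>; \<open>q_fun_eq\<close> relates it to the sum over the next
  states.\<close>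

lemma value_fun_return:
  assumes "h < horizon M"
  shows "value_fun M \<pi> h (return_pmf s) =
    (\<Sum>a\<in>UNIV. pmf (\<pi> h s) a * (reward M s a + value_fun M \<pi> (h + 1) (trans M s a)))"
proof -
  have n: "horizon M - h = Suc (horizon M - (h + 1))" using assms by simp
  have "measure_pmf.expectation (trajectory M \<pi> (h + 1) n \<nu>) (\<lambda>\<tau>. reward M s a + f \<tau>) =
      reward M s a + measure_pmf.expectation (trajectory M \<pi> (h + 1) n \<nu>) f"
    for n \<nu> a and f :: "('a \<times> 'b) list \<Rightarrow> real"
    by (subst Bochner_Integration.integral_add)
      (auto intro: integrable_measure_pmf_finite finite_set_trajectory)
  then show ?thesis
    unfolding value_fun_def n trajectory.simps bind_return_pmf
    by (subst pmf_expectation_bind[of UNIV])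
      (auto simp: integral_map_pmf case_prod_beta intro: finite_set_trajectory)
qed

lemma value_fun_bounds:
  assumes "finite_time_mdp M R"
  shows "0 \<le> value_fun M \<pi> h \<mu> \<and> value_fun M \<pi> h \<mu> \<le> real (horizon M - h) * R"
proof (induction "horizon M - h" arbitrary: h \<mu>)
  case 0
  then show ?case by (simp add: value_fun_end)
next
  case (Suc n)
  have R: "0 \<le> reward M s a" "reward M s a \<le> R" for s a
    using assms by (auto simp: finite_time_mdp_def)
  define B where "B = real (horizon M - h) * R"
  have IH: "0 \<le> value_fun M \<pi> (h + 1) \<nu>" "value_fun M \<pi> (h + 1) \<nu> \<le> B - R" for \<nu>
  proof -
    have "real (horizon M - (h + 1)) = real (horizon M - h) - 1" using Suc(2) by linarith
    then have "real (horizon M - (h + 1)) * R = B - R" by (simp add: B_def left_diff_distrib)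
    moreover have "0 \<le> value_fun M \<pi> (h + 1) \<nu> \<and>
        value_fun M \<pi> (h + 1) \<nu> \<le> real (horizon M - (h + 1)) * R"
      by (rule Suc.hyps(1)) (use Suc(2) in simp)
    ultimately show "0 \<le> value_fun M \<pi> (h + 1) \<nu>" "value_fun M \<pi> (h + 1) \<nu> \<le> B - R" by auto
  qed
  \<comment> \<open>Stated with its own type variable, since it serves for averages over actions and
    over states.\<close>
  have avg: "0 \<le> (\<Sum>x\<in>UNIV. pmf p x * f x) \<and> (\<Sum>x\<in>UNIV. pmf p x * f x) \<le> B"
    if f: "\<And>x. 0 \<le> f x \<and> f x \<le> B" for p :: "'x::finite pmf" and f
  proof -
    have "(\<Sum>x\<in>UNIV. pmf p x * f x) \<le> (\<Sum>x\<in>UNIV. pmf p x * B)"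
      using f by (intro sum_mono mult_left_mono) auto
    then show ?thesis using f sum_pmf_eq_1[of UNIV p]
      by (auto simp: sum_nonneg simp flip: sum_distrib_right)
  qed
  have "0 \<le> value_fun M \<pi> h (return_pmf s) \<and> value_fun M \<pi> h (return_pmf s) \<le> B" for s
  proof -
    have "h < horizon M" using Suc(2) by simp
    moreover have "0 \<le> reward M s a + value_fun M \<pi> (h + 1) (trans M s a) \<and>
        reward M s a + value_fun M \<pi> (h + 1) (trans M s a) \<le> B" for a
      using R[of s a] IH[of "trans M s a"] by auto
    ultimately show ?thesis by (simp only: value_fun_return avg)
  qed
  then show ?case unfolding B_def[symmetric] by (subst (1 2) value_fun_eq_sum) (rule avg)
qed

lemma q_fun_eq:
  assumes mdp: "finite_time_mdp M R" and "h < horizon M" "s \<in> states M h" "a \<in> actions M s"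
  shows "q_fun M \<pi> h s a = reward M s a + value_fun M \<pi> (h + 1) (trans M s a)"
proof (cases "h + 1 < horizon M")
  case True
  then have "measure_pmf.prob (trans M s a) (states M (h + 1)) = 1"
    using assms by (auto simp: finite_time_mdp_def)
  then have "value_fun M \<pi> (h + 1) (trans M s a) =
      (\<Sum>s'\<in>states M (h + 1). pmf (trans M s a) s' * value_fun M \<pi> (h + 1) (return_pmf s'))"
    by (subst value_fun_eq_sum) (auto intro!: sum.mono_neutral_right simp: pmf_eq_0_outside)
  then show ?thesis using True by (simp add: q_fun_def)
qed (simp add: q_fun_def value_fun_end)

lemma q_fun_bounds:
  assumes "finite_time_mdp M R" "h < horizon M" "s \<in> states M h" "a \<in> actions M s"
  shows "0 \<le> q_fun M \<pi> h s a \<and> q_fun M \<pi> h s a \<le> real (horizon M - h) * R"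
proof -
  have "real (horizon M - (h + 1)) = real (horizon M - h) - 1" using assms by linarith
  then have "real (horizon M - (h + 1)) * R = real (horizon M - h) * R - R"
    by (simp add: left_diff_distrib)
  moreover have "0 \<le> reward M s a" "reward M s a \<le> R"
    using assms by (auto simp: finite_time_mdp_def)
  ultimately show ?thesis
    using value_fun_bounds[OF assms(1), of \<pi> "h + 1" "trans M s a"] unfolding q_fun_eq[OF assms]
    by linarith
qed

lemma value_fun_return_q_fun:
  assumes "finite_time_mdp M R" "h < horizon M" "s \<in> states M h"
    and "measure_pmf.prob (\<pi> h s) (actions M s) = 1"
  shows "value_fun M \<pi> h (return_pmf s) = (\<Sum>a\<in>actions M s. pmf (\<pi> h s) a * q_fun M \<pi> h s a)"
  using assms
  by (auto simp: value_fun_return q_fun_eq pmf_eq_0_outside intro!: sum.mono_neutral_cong_right)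

section \<open>Softmax policies and their gradients\<close>

lemma pmf_softmax_eq_weight:
  "a \<in> actions M s \<Longrightarrow> pmf (softmax M \<theta> s) a = softmax_weight (actions M s) (\<lambda>a. \<theta> $ (s, a)) a"
  by (subst pmf_softmax) (auto simp: softmax_weight_def)

lemma prob_softmax:
  "actions M s \<noteq> {} \<Longrightarrow> measure_pmf.prob (softmax M \<theta> s) (actions M s) = 1"
  by (simp add: measure_measure_pmf_finite pmf_softmax_eq_weight sum_softmax_weight)

text \<open>\<open>q_fun\<close> at epoch \<open>h\<close> looks only at later epochs, so changing
  the policy in epoch \<open>h\<close> leaves it fixed. This turns the epoch into one bandit per
  state.\<close>

lemma value_fun_softmax:
  assumes "finite_time_mdp M R" "h < horizon M" "s \<in> states M h"
  shows "value_fun M (\<pi>(h := softmax M \<theta>)) h (return_pmf s) =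
    softmax_mean (actions M s) (q_fun M \<pi> h s) (\<lambda>a. \<theta> $ (s, a))"
proof -
  have "q_fun M (\<pi>(h := softmax M \<theta>)) h s a = q_fun M \<pi> h s a" for a
    unfolding q_fun_def by (simp cong: value_fun_cong_future)
  moreover have "actions M s \<noteq> {}" using assms by (simp add: finite_time_mdp_def)
  ultimately show ?thesis
    by (subst value_fun_return_q_fun[OF assms])
      (simp_all add: prob_softmax softmax_mean_def pmf_softmax_eq_weight)
qed

text \<open>Uniqueness for the definite description: the derivative is unique, and so is the vector
  representing it by the inner product.\<close>

lemma gradient_eqI: "GDERIV f x :> g \<Longrightarrow> gradient f x = g"
  unfolding gradient_def gderiv_def
  by (rule the_equality) (auto dest: has_derivative_unique simp: fun_eq_iff vector_eq_ldot)

text \<open>Quotient rule for a ratio of sums of exponentials.\<close>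

lemma has_derivative_softmax_mean:
  assumes "finite A" "A \<noteq> {}"
  shows "((\<lambda>x :: real ^ ('s::finite \<times> 'a::finite). softmax_mean A q (\<lambda>a. x $ (s, a))) has_derivative
    (\<lambda>y. \<Sum>a\<in>A. y $ (s, a) * (softmax_weight A (\<lambda>a. \<theta> $ (s, a)) a *
      (q a - softmax_mean A q (\<lambda>a. \<theta> $ (s, a)))))) (at \<theta>)"
proof -
  let ?Z = "\<lambda>x :: real ^ ('s \<times> 'a). \<Sum>a\<in>A. exp (x $ (s, a))"
  let ?N = "\<lambda>x :: real ^ ('s \<times> 'a). \<Sum>a\<in>A. exp (x $ (s, a)) * q a"
  have Z: "?Z \<theta> \<noteq> 0" using sum_exp_pos[OF assms, of "\<lambda>a. \<theta> $ (s, a)"] by simp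
  have mean: "softmax_mean A q (\<lambda>a. x $ (s, a)) = ?N x / ?Z x" for x
    by (simp add: softmax_mean_def softmax_weight_def sum_divide_distrib)
  have e: "((\<lambda>x :: real ^ ('s \<times> 'a). exp (x $ (s, a))) has_derivative
      (\<lambda>y. y $ (s, a) * exp (\<theta> $ (s, a)))) (at \<theta>)" for a
    by (intro has_derivative_eq_rhs[OF has_derivative_exp[OF
          bounded_linear.has_derivative[OF bounded_linear_vec_nth has_derivative_ident]]]) auto
  have "((\<lambda>x. ?N x / ?Z x) has_derivative
      (\<lambda>y. - ?N \<theta> * (inverse (?Z \<theta>) * (\<Sum>a\<in>A. y $ (s, a) * exp (\<theta> $ (s, a))) * inverse (?Z \<theta>)) +
        (\<Sum>a\<in>A. y $ (s, a) * exp (\<theta> $ (s, a)) * q a) / ?Z \<theta>)) (at \<theta>)"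
    by (intro has_derivative_divide has_derivative_sum has_derivative_mult_left e Z)
  moreover have "(\<Sum>a\<in>A. y $ (s, a) * (softmax_weight A (\<lambda>a. \<theta> $ (s, a)) a * (q a - ?N \<theta> / ?Z \<theta>))) =
      - ?N \<theta> * (inverse (?Z \<theta>) * (\<Sum>a\<in>A. y $ (s, a) * exp (\<theta> $ (s, a))) * inverse (?Z \<theta>)) +
        (\<Sum>a\<in>A. y $ (s, a) * exp (\<theta> $ (s, a)) * q a) / ?Z \<theta>" for y
  proof -
    \<comment> \<open>A generic \<open>m\<close> keeps the quotient that stands for the mean opaque
      during the expansion.\<close>
    have *: "(\<Sum>a\<in>A. y $ (s, a) * (softmax_weight A (\<lambda>a. \<theta> $ (s, a)) a * (q a - m))) =
        (\<Sum>a\<in>A. y $ (s, a) * exp (\<theta> $ (s, a)) * q a) / ?Z \<theta> -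
          m * (\<Sum>a\<in>A. y $ (s, a) * exp (\<theta> $ (s, a))) / ?Z \<theta>" for m
      unfolding softmax_weight_def sum_distrib_left sum_divide_distrib sum_subtractf[symmetric]
      by (intro sum.cong) (auto simp: algebra_simps diff_divide_distrib)
    show ?thesis unfolding *[of "?N \<theta> / ?Z \<theta>"] by (simp add: divide_inverse mult_ac)
  qed
  ultimately show ?thesis by (simp only: mean)
qed

text \<open>The objective is a \<open>\<mu>\<close>-weighted sum of bandit means, and the coordinate
  \<open>(s, a)\<close> enters only the mean of state \<open>s\<close>. This is the decoupling over
  states.\<close>

lemma gradient_value_fun:
  fixes M :: "('s::finite, 'a::finite) mdp" and \<theta> :: "('s, 'a) param"
  assumes mdp: "finite_time_mdp M R" and h: "h < horizon M"
    and \<mu>: "measure_pmf.prob \<mu> (states M h) = 1"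
  shows "gradient (\<lambda>x. value_fun M (\<pi>(h := softmax M x)) h \<mu>) \<theta> =
    (\<chi> i. if fst i \<in> states M h \<and> snd i \<in> actions M (fst i)
      then pmf \<mu> (fst i) * (softmax_weight (actions M (fst i)) (\<lambda>a. \<theta> $ (fst i, a)) (snd i) *
        (q_fun M \<pi> h (fst i) (snd i) -
          softmax_mean (actions M (fst i)) (q_fun M \<pi> h (fst i)) (\<lambda>a. \<theta> $ (fst i, a))))
      else 0)"
    (is "_ = ?g")
proof (rule gradient_eqI)
  let ?d = "\<lambda>s a. softmax_weight (actions M s) (\<lambda>a. \<theta> $ (s, a)) a *
    (q_fun M \<pi> h s a - softmax_mean (actions M s) (q_fun M \<pi> h s) (\<lambda>a. \<theta> $ (s, a)))"
  have ne: "actions M s \<noteq> {}" for s using mdp by (simp add: finite_time_mdp_def)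
  have "value_fun M (\<pi>(h := softmax M x)) h \<mu> =
      (\<Sum>s\<in>states M h. pmf \<mu> s * softmax_mean (actions M s) (q_fun M \<pi> h s) (\<lambda>a. x $ (s, a)))" for x
    using \<mu> by (subst value_fun_eq_sum)
      (auto intro!: sum.mono_neutral_cong_right simp: pmf_eq_0_outside value_fun_softmax[OF mdp h])
  moreover have "((\<lambda>x. \<Sum>s\<in>states M h. pmf \<mu> s *
        softmax_mean (actions M s) (q_fun M \<pi> h s) (\<lambda>a. x $ (s, a))) has_derivative
      (\<lambda>y. \<Sum>s\<in>states M h. pmf \<mu> s * (\<Sum>a\<in>actions M s. y $ (s, a) * ?d s a))) (at \<theta>)"
    by (intro has_derivative_sum has_derivative_mult_right has_derivative_softmax_mean ne) simp
  moreover have "(\<Sum>s\<in>states M h. pmf \<mu> s * (\<Sum>a\<in>actions M s. y $ (s, a) * ?d s a)) = inner y ?g" for y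
  proof -
    have "inner y ?g = (\<Sum>i\<in>UNIV. y $ i * ?g $ i)" by (simp add: inner_vec_def)
    also have "\<dots> = (\<Sum>i\<in>Sigma (states M h) (actions M). y $ i * ?g $ i)"
      by (intro sum.mono_neutral_right) auto
    also have "\<dots> = (\<Sum>(s, a)\<in>Sigma (states M h) (actions M). pmf \<mu> s * (y $ (s, a) * ?d s a))"
      by (intro sum.cong) auto
    also have "\<dots> = (\<Sum>s\<in>states M h. \<Sum>a\<in>actions M s. pmf \<mu> s * (y $ (s, a) * ?d s a))"
      by (simp add: sum.Sigma)
    finally show ?thesis by (simp add: sum_distrib_left)
  qed
  ultimately show "GDERIV (\<lambda>x. value_fun M (\<pi>(h := softmax M x)) h \<mu>) \<theta> :> ?g"
    by (simp add: gderiv_def)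
qed

subsection \<open>Dynamic policy gradient\<close>

text \<open>Backward induction: the losses of the later epochs pass unchanged through the average
  over next states, and the current epoch adds one more \<open>e\<close>.\<close>

lemma value_fun_le_if_one_step_greedy:
  assumes mdp: "finite_time_mdp M R" and pol: "is_policy M \<pi>" "is_policy M \<pi>'"
    and greedy: "\<And>h s a. h < horizon M \<Longrightarrow> s \<in> states M h \<Longrightarrow> a \<in> actions M s \<Longrightarrow>
      q_fun M \<pi> h s a \<le> value_fun M \<pi> h (return_pmf s) + e"
    and "h < horizon M" "s \<in> states M h"
  shows "value_fun M \<pi>' h (return_pmf s) \<le> value_fun M \<pi> h (return_pmf s) + real (horizon M - h) * e"
  using assms(5,6)
proof (induction "horizon M - h" arbitrary: h s rule: less_induct)
  case less
  let ?b = "real (horizon M - (h + 1)) * e"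
  have supp: "measure_pmf.prob (\<pi>' h s) (actions M s) = 1"
    using pol less.prems by (simp add: is_policy_def)
  have q: "q_fun M \<pi>' h s a \<le> q_fun M \<pi> h s a + ?b" if a: "a \<in> actions M s" for a
  \<comment> \<open>In the last epoch both action values equal the reward, and \<open>?b\<close> is
    0.\<close>
  proof (cases "h + 1 < horizon M")
    case True
    let ?S = "states M (h + 1)" and ?p = "trans M s a"
    have "measure_pmf.prob ?p ?S = 1"
      using mdp True a less.prems by (auto simp: finite_time_mdp_def)
    then have 1: "(\<Sum>s'\<in>?S. pmf ?p s') = 1" by (simp add: measure_measure_pmf_finite)
    have "(\<Sum>s'\<in>?S. pmf ?p s' * value_fun M \<pi>' (h + 1) (return_pmf s')) \<le>
        (\<Sum>s'\<in>?S. pmf ?p s' * (value_fun M \<pi> (h + 1) (return_pmf s') + ?b))"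
      using True by (intro sum_mono mult_left_mono less.hyps) auto
    also have "\<dots> = (\<Sum>s'\<in>?S. pmf ?p s' * value_fun M \<pi> (h + 1) (return_pmf s')) + ?b"
      using 1 by (simp add: distrib_left sum.distrib flip: sum_distrib_right)
    finally show ?thesis using True by (simp add: q_fun_def)
  qed (simp add: q_fun_def)
  have e: "?b + e = real (horizon M - h) * e"
  proof -
    have "real (horizon M - h) = real (horizon M - (h + 1)) + 1" using less.prems by linarith
    then show ?thesis by (simp only: distrib_right mult_1)
  qed
  have "value_fun M \<pi>' h (return_pmf s) =
      (\<Sum>a\<in>actions M s. pmf (\<pi>' h s) a * q_fun M \<pi>' h s a)"
    by (rule value_fun_return_q_fun[where \<pi> = \<pi>', OF mdp less.prems supp])
  also have "\<dots> \<le> (\<Sum>a\<in>actions M s. pmf (\<pi>' h s) a *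
      (value_fun M \<pi> h (return_pmf s) + real (horizon M - h) * e))"
    using q greedy[OF less.prems] unfolding e[symmetric]
    by (intro sum_mono mult_left_mono) (auto, smt (verit))
  also have "\<dots> = value_fun M \<pi> h (return_pmf s) + real (horizon M - h) * e"
    using supp by (simp add: measure_measure_pmf_finite flip: sum_distrib_right)
  finally show ?case .
qed

lemma best_actions_iff:
  "b \<in> best_actions M \<pi> h s \<longleftrightarrow>
    b \<in> actions M s \<and> (\<forall>a\<in>actions M s. q_fun M \<pi> h s a \<le> q_fun M \<pi> h s b)"
  by (auto simp: best_actions_def is_arg_max_def not_less)

text \<open>The step numbers \<open>N\<close> stay arbitrary here. Where they matter, they are
  prescribed through a freely chosen constant, which allows \<open>ascent_const\<close> and
  \<open>1 / CARD('a)\<close> to be treated alike.\<close>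

locale dynamic_pg_run =
  fixes M :: "('s::finite, 'a::finite) mdp" and R :: real and \<mu> :: "nat \<Rightarrow> 's pmf"
    and \<eta> :: "nat \<Rightarrow> real" and N :: "nat \<Rightarrow> nat" and \<theta> :: "nat \<Rightarrow> nat \<Rightarrow> ('s, 'a) param"
    and \<pi> :: "('s, 'a) policy"
  assumes mdp: "finite_time_mdp M R"
    and mu_prob: "\<forall>h<horizon M. measure_pmf.prob (\<mu> h) (states M h) = 1"
    and mu_pos: "\<forall>h<horizon M. \<forall>s\<in>states M h. pmf (\<mu> h) s > 0"
    and eta: "\<forall>h<horizon M. \<eta> h = 1 / (2 * real (horizon M - h) * R)"
    and run: "dynamic_pg M \<mu> \<eta> N \<theta> \<pi>"
begin

section \<open>From bandits to the run of the algorithm\<close>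

lemma actions_ne: "actions M s \<noteq> {}"
  using mdp by (simp add: finite_time_mdp_def)

lemma R_pos: "R > 0"
  using mdp by (simp add: finite_time_mdp_def)

lemma policy: "is_policy M \<pi>"
  using run by (simp add: is_policy_def dynamic_pg_def prob_softmax actions_ne)

text \<open>Reads the gradient formula at the coordinates of one state; the factor
  \<open>pmf (\<mu> h) s\<close> is absorbed into the step size.\<close>

lemma state_ascent:
  assumes h: "h < horizon M" "s \<in> states M h"
  shows "softmax_ascent (actions M s) (q_fun M \<pi> h s) (\<eta> h * pmf (\<mu> h) s)
    (\<lambda>n a. \<theta> h n $ (s, a))"
proof
  show "0 < \<eta> h * pmf (\<mu> h) s"
    using eta mu_pos h R_pos by simp
  fix a n assume "a \<in> actions M s"
  then show "\<theta> h (Suc n) $ (s, a) = \<theta> h n $ (s, a) + \<eta> h * pmf (\<mu> h) s *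
      (softmax_weight (actions M s) (\<lambda>a. \<theta> h n $ (s, a)) a *
        (q_fun M \<pi> h s a - softmax_mean (actions M s) (q_fun M \<pi> h s) (\<lambda>a. \<theta> h n $ (s, a))))"
    using run h mu_prob gradient_value_fun[OF mdp h(1), of "\<mu> h" \<pi> "\<theta> h n"]
    by (simp add: dynamic_pg_def)
qed (simp_all add: actions_ne)

lemma value_fun_run:
  assumes "h < horizon M" "s \<in> states M h"
  shows "value_fun M \<pi> h (return_pmf s) =
    softmax_mean (actions M s) (q_fun M \<pi> h s) (\<lambda>a. \<theta> h (N h) $ (s, a))"
proof -
  have "\<pi>(h := softmax M (\<theta> h (N h))) = \<pi>"
    using run assms by (auto simp: dynamic_pg_def)
  then show ?thesis using value_fun_softmax[OF mdp assms, of \<pi> "\<theta> h (N h)"] by simp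
qed

text \<open>The prescribed number of steps is exactly what brings the bound of
  \<open>suboptimality_rate\<close> down to \<epsilon>/H, with \<open>inv_sup_norm\<close> covering
  the least likely state.\<close>

lemma epoch_nearly_greedy:
  assumes h: "h < horizon M" "s \<in> states M h" and eps: "\<epsilon> > 0"
    and b: "b \<in> best_actions M \<pi> h s" and c: "c > 0" "\<And>n. c \<le> pmf (softmax M (\<theta> h n) s) b"
    and N: "N h = training_steps M R \<mu> \<epsilon> h c" and a: "a \<in> actions M s"
  shows "q_fun M \<pi> h s a \<le> value_fun M \<pi> h (return_pmf s) + \<epsilon> / real (horizon M)"
proof -
  define C where "C = real (horizon M - h) * R"
  let ?k = "\<eta> h * pmf (\<mu> h) s" and ?H = "real (horizon M)"
  let ?d = "q_fun M \<pi> h s b - value_fun M \<pi> h (return_pmf s)"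
  interpret softmax_ascent "actions M s" "q_fun M \<pi> h s" ?k "\<lambda>n a. \<theta> h n $ (s, a)"
    by (rule state_ascent[OF h])
  have C: "C > 0" using h R_pos by (simp add: C_def)
  have mu: "pmf (\<mu> h) s > 0" using mu_pos h by simp
  have eta': "\<eta> h = 1 / (2 * C)" using eta h by (simp add: C_def)
  have kC: "?k * C \<le> 1 / 2"
    using C pmf_le_1[of "\<mu> h" s] unfolding eta' by (simp add: field_simps)
  have d: "?d \<ge> 0"
    using b by (simp add: value_fun_run[OF h] best_actions_iff softmax_mean_le actions_ne)
  have rate: "?k / 2 * c\<^sup>2 * real (N h) * ?d \<le> 1"
    unfolding value_fun_run[OF h]
    using b c kC q_fun_bounds[OF mdp h, of _ \<pi>]
    by (intro suboptimality_rate) (auto simp: best_actions_iff pmf_softmax_eq_weight C_def)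
  have "1 / pmf (\<mu> h) s \<le> inv_sup_norm M \<mu> h"
    unfolding inv_sup_norm_def using h by (intro Max_ge) auto
  then have "4 * C * ?H / (c\<^sup>2 * \<epsilon>) * (1 / pmf (\<mu> h) s) \<le>
      4 * C * ?H / (c\<^sup>2 * \<epsilon>) * inv_sup_norm M \<mu> h"
    using C eps by (intro mult_left_mono) auto
  also have "\<dots> = 4 * real (horizon M - h) * ?H * R / (c\<^sup>2 * \<epsilon>) * inv_sup_norm M \<mu> h"
    by (simp add: C_def mult_ac)
  also have "\<dots> \<le> real (N h)" unfolding N training_steps_def by linarith
  finally have le: "?k / 2 * c\<^sup>2 * (4 * C * ?H / (c\<^sup>2 * \<epsilon>) * (1 / pmf (\<mu> h) s)) * ?d \<le>
      ?k / 2 * c\<^sup>2 * real (N h) * ?d"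
    using d k_pos by (intro mult_right_mono mult_left_mono) auto
  \<comment> \<open>Here \<open>?k / 2\<close> is \<open>pmf (\<mu> h) s / (4 * C)\<close>, which
    explains the factor 4 in the number of steps.\<close>
  have eq: "?k / 2 * c\<^sup>2 * (4 * C * ?H / (c\<^sup>2 * \<epsilon>) * (1 / pmf (\<mu> h) s)) = ?H / \<epsilon>"
    unfolding eta' using C mu c(1) eps by (simp add: field_simps)
  have "?H / \<epsilon> * ?d \<le> 1" using le rate unfolding eq by (rule order.trans)
  then have "?d \<le> \<epsilon> / ?H" using eps h by (simp add: field_simps)
  moreover have "q_fun M \<pi> h s a \<le> q_fun M \<pi> h s b" using a b by (simp add: best_actions_iff)
  ultimately show ?thesis by simp
qed

lemma states_ne: "h < horizon M \<Longrightarrow> states M h \<noteq> {}"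
  using mu_prob by force

lemma ascent_const_le:
  assumes "h < horizon M" "s \<in> states M h"
  shows "ascent_const M \<theta> b h \<le> pmf (softmax M (\<theta> h n) s) (b h s)"
proof -
  let ?m = "\<lambda>n. Min ((\<lambda>s. pmf (softmax M (\<theta> h n) s) (b h s)) ` states M h)"
  have "bdd_below (range ?m)"
    using states_ne[OF assms(1)] by (intro bdd_belowI2[of _ 0] Min.boundedI) auto
  then have "ascent_const M \<theta> b h \<le> ?m n"
    unfolding ascent_const_def by (intro cINF_lower) auto
  also have "\<dots> \<le> pmf (softmax M (\<theta> h n) s) (b h s)"
    using assms by (intro Min_le) auto
  finally show ?thesis .
qed

text \<open>Each state has a positive bound valid for all iterates, and there are only finitely many
  states.\<close>

lemma ascent_const_pos:
  assumes h: "h < horizon M" and unique: "\<forall>s\<in>states M h. best_actions M \<pi> h s = {b h s}"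
  shows "ascent_const M \<theta> b h > 0"
proof -
  have "\<exists>c>0. \<forall>n. c \<le> pmf (softmax M (\<theta> h n) s) (b h s)" if s: "s \<in> states M h" for s
  proof -
    interpret softmax_ascent "actions M s" "q_fun M \<pi> h s" "\<eta> h * pmf (\<mu> h) s"
      "\<lambda>n a. \<theta> h n $ (s, a)"
      by (rule state_ascent[OF h s])
    have u: "a \<in> best_actions M \<pi> h s \<longleftrightarrow> a = b h s" for a using unique s by simp
    have b: "b h s \<in> actions M s" using u[of "b h s"] by (simp add: best_actions_iff)
    have "q_fun M \<pi> h s a < q_fun M \<pi> h s (b h s)" if "a \<in> actions M s" "a \<noteq> b h s" for a
      using u[of a] u[of "b h s"] that unfolding best_actions_iff by (force simp: not_le)
    then show ?thesis
      using unique_best_weight_bounded_below[OF b] b by (simp add: pmf_softmax_eq_weight)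
  qed
  then obtain c where c: "\<And>s. s \<in> states M h \<Longrightarrow> c s > 0"
    "\<And>s n. s \<in> states M h \<Longrightarrow> c s \<le> pmf (softmax M (\<theta> h n) s) (b h s)"
    by metis
  have "0 < Min (c ` states M h)" using c states_ne[OF h] by simp
  also have "\<dots> \<le> ascent_const M \<theta> b h"
    unfolding ascent_const_def using c states_ne[OF h]
    by (intro cINF_greatest) (auto simp: Min_le_iff intro!: Min.boundedI)
  finally show ?thesis .
qed

text \<open>Equal initial weights mean equal initial parameters within the state, so any best action
  starts as a most likely one. Its weight is then at least the reciprocal of the number of actions
  available in the state.\<close>

lemma uniform_init_weight_ge:
  assumes h: "h < horizon M" "s \<in> states M h" and unif: "uniform_init M \<theta> h"
    and b: "b \<in> best_actions M \<pi> h s"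
  shows "1 / real CARD('a) \<le> pmf (softmax M (\<theta> h n) s) b"
proof -
  interpret softmax_ascent "actions M s" "q_fun M \<pi> h s" "\<eta> h * pmf (\<mu> h) s"
    "\<lambda>n a. \<theta> h n $ (s, a)"
    by (rule state_ascent[OF h])
  have "p 0 a = 1 / real (card (actions M s))" if "a \<in> actions M s" for a
    using unif h that pmf_softmax_eq_weight[OF that, of "\<theta> h 0"] actions_ne[of s]
    by (simp add: uniform_init_def)
  then have "p 0 a = p 0 b" if "a \<in> actions M s" for a
    using b that by (simp add: best_actions_iff)
  then have init: "\<theta> h 0 $ (s, a) \<le> \<theta> h 0 $ (s, b)" if "a \<in> actions M s" for a
    using that Z_pos[of 0] by (simp add: softmax_weight_def)
  have "1 / real (card (actions M s)) \<le> p n b"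
    using b init by (intro best_weight_ge_inverse_card) (auto simp: best_actions_iff)
  moreover have "1 / real CARD('a) \<le> 1 / real (card (actions M s))"
    using actions_ne[of s] by (intro divide_left_mono) (auto simp: card_gt_0_iff card_mono)
  ultimately show ?thesis using b by (simp add: best_actions_iff pmf_softmax_eq_weight)
qed

text \<open>Each of the H epochs loses at most \<epsilon>/H against every competing policy. The
  constant may vary with the epoch.\<close>

lemma optimality_gap:
  assumes eps: "\<epsilon> > 0"
    and b: "\<And>h s. h < horizon M \<Longrightarrow> s \<in> states M h \<Longrightarrow> b h s \<in> best_actions M \<pi> h s"
    and c: "\<And>h. h < horizon M \<Longrightarrow> c h > 0"
      "\<And>h s n. h < horizon M \<Longrightarrow> s \<in> states M h \<Longrightarrow> c h \<le> pmf (softmax M (\<theta> h n) s) (b h s)"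
    and N: "\<And>h. h < horizon M \<Longrightarrow> N h = training_steps M R \<mu> \<epsilon> h (c h)"
    and s: "s \<in> states M 0"
  shows "opt_value M s - value_fun M \<pi> 0 (return_pmf s) \<le> \<epsilon>"
proof -
  \<comment> \<open>With no epochs the state sets could not cover the nonempty state space.\<close>
  have H: "0 < horizon M" using mdp by (auto simp: finite_time_mdp_def intro: gr0I)
  have "value_fun M \<pi>' 0 (return_pmf s) \<le> value_fun M \<pi> 0 (return_pmf s) + \<epsilon>"
    if "is_policy M \<pi>'" for \<pi>'
    using value_fun_le_if_one_step_greedy[OF mdp policy that _ H s, of "\<epsilon> / real (horizon M)"]
      epoch_nearly_greedy[OF _ _ eps b c N] H by simp
  then have "opt_value M s \<le> value_fun M \<pi> 0 (return_pmf s) + \<epsilon>"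
    unfolding opt_value_def using policy by (intro cSUP_least) auto
  then show ?thesis by simp
qed

end

theorem theorem3p5:
  fixes M :: "('s::finite, 'a::finite) mdp"
    and R \<epsilon> :: real
    and \<mu> :: "nat \<Rightarrow> 's pmf"
    and \<eta> c :: "nat \<Rightarrow> real"
    and N :: "nat \<Rightarrow> nat"
    and \<theta> :: "nat \<Rightarrow> nat \<Rightarrow> ('s, 'a) param"
    and \<pi> :: "('s, 'a) policy"
    and abest :: "nat \<Rightarrow> 's \<Rightarrow> 'a"
  assumes mdp: "finite_time_mdp M R"
    and mu_prob: "\<forall>h<horizon M. measure_pmf.prob (\<mu> h) (states M h) = 1"
    and mu_pos: "\<forall>h<horizon M. \<forall>s\<in>states M h. pmf (\<mu> h) s > 0"
    and eta: "\<forall>h<horizon M. \<eta> h = 1 / (2 * real (horizon M - h) * R)"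
    and eps: "\<epsilon> > 0"
    and run: "dynamic_pg M \<mu> \<eta> N \<theta> \<pi>"
    and abest: "\<forall>h<horizon M. \<forall>s\<in>states M h. abest h s \<in> best_actions M \<pi> h s"
    and c: "\<forall>h<horizon M. c h = ascent_const M \<theta> abest h"
    \<comment> \<open>The constant is positive if best actions are unique. It can vanish for an unlucky
        choice among several best actions, and then the number of steps is undefined.\<close>
    and ties: "\<forall>h<horizon M. (\<forall>s\<in>states M h. best_actions M \<pi> h s = {abest h s}) \<or> c h > 0"
  shows "((\<forall>h<horizon M. N h = training_steps M R \<mu> \<epsilon> h (c h)) \<longrightarrow>
            (\<forall>s\<in>states M 0. opt_value M s - value_fun M \<pi> 0 (return_pmf s) \<le> \<epsilon>)) \<and>
         (\<forall>U. (\<forall>h\<in>U. uniform_init M \<theta> h) \<longrightarrow>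
            (\<forall>h<horizon M. N h =
               training_steps M R \<mu> \<epsilon> h (if h \<in> U then 1 / real CARD('a) else c h)) \<longrightarrow>
            (\<forall>s\<in>states M 0. opt_value M s - value_fun M \<pi> 0 (return_pmf s) \<le> \<epsilon>))"
proof -
  interpret dynamic_pg_run M R \<mu> \<eta> N \<theta> \<pi>
    by unfold_locales (fact mdp mu_prob mu_pos eta run)+
  have c_pos: "c h > 0" if "h < horizon M" for h
    using that ties c ascent_const_pos[OF that, of abest] by auto
  have c_le: "c h \<le> pmf (softmax M (\<theta> h n) s) (abest h s)"
    if "h < horizon M" "s \<in> states M h" for h s n
    using that c ascent_const_le[OF that] by simp
  \<comment> \<open>Both claims at once: the first is the case of an empty set \<open>U\<close> of
    uniformly initialised epochs.\<close>
  have "opt_value M s - value_fun M \<pi> 0 (return_pmf s) \<le> \<epsilon>"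
    if U: "\<forall>h\<in>U. uniform_init M \<theta> h"
      and N: "\<forall>h<horizon M. N h =
        training_steps M R \<mu> \<epsilon> h (if h \<in> U then 1 / real CARD('a) else c h)"
      and s: "s \<in> states M 0" for U s
    using abest c_pos c_le N s uniform_init_weight_ge U
    by (intro optimality_gap[OF eps, where b = abest
          and c = "\<lambda>h. if h \<in> U then 1 / real CARD('a) else c h"]) auto
  from this[of "{}"] this show ?thesis by simp
qed

end
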